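(* Let $p,q\in\mathbb C[x]$ be polynomials and consider the Abel equation $y'=p(x)y^2+q(x)y^3$. Let $a,b\in\mathbb C$ with $b$ different from all the zeroes of $q$, let $s$ be a path in $\mathbb C$ from $a$ to $b$, and let $\sigma:[0,1]\to\mathbb C$ be a path in the plane of initial values at $a$, from $w_0=\sigma(0)$ to $w_1=\sigma(1)$; write $w_t=\sigma(t)$. Assume that there exists a family $s_t$, $t\in[0,1]$, of paths from $a$ to $b$ such that: 1. $s_t$ is a continuous in $t$ deformation of the original path $s$, with $s_0=s$; 2. for each $t\in[0,1]$ the solution $y(w_t,x)$, continued from $a$ along $s_t$, is regular at each point of $s_t$. Then the germ $\phi_{a,b,s,w_0}$ at $w_0$ of the Poincaré mapping along $s$ allows for the analytic continuation along $\sigma$ from $w_0$ to $w_1$. The continued germ at $w_1$ is $\phi_{a,b,s_1,w_1}$, i.e. it is provided by the analytic continuation along $s_1$ of the solutions starting (at $a$) near $w_1$.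
   Context: All variables are complex. For $w\in\mathbb C$, $y(w,x)$ denotes the solution of $y'=p(x)y^2+q(x)y^3$ with $y(w,a)=w$ (a holomorphic function of $x$ near $a$), and its analytic continuations. Paths are allowed to pass through zeroes of $q$. Poincaré mapping: let $s$ be a path from $a$ to $b$ and $y_a^0\in\mathbb C$ such that the solution $y(y_a^0,x)$ can be analytically continued along $s$ from a neighborhood of $a$, without singularities on $s$ (including $b$). The germ at $y_a^0$ of the Poincaré mapping along $s$, denoted $\phi_{a,b,s,y_a^0}$, associates to each $y_a$ near $y_a^0$ the value $\phi(y_a)=y(y_a,b)$ at $b$ of the solution $y(y_a,x)$ continued to $b$ along $s$. *)

theory Defs
  imports "HOL-Complex_Analysis.Complex_Analysis"
begin

text \<open>
  Analytic continuation along a path \<open>\<gamma>\<close>: for every \<open>t\<close> in the unit interval, only the germ of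
  \<open>F t\<close> at \<open>\<gamma> t\<close> is meaningful. The germ being continued is that of \<open>F 0\<close>, and the
  result of the continuation is the germ of \<open>F 1\<close> at the endpoint of \<open>\<gamma>\<close>.
\<close>

definition analytic_continuation_along ::
    "(real \<Rightarrow> complex) \<Rightarrow> (real \<Rightarrow> complex \<Rightarrow> complex) \<Rightarrow> bool" where
  "analytic_continuation_along \<gamma> F \<longleftrightarrow>
     (\<forall>t\<in>{0..1}. F t analytic_on {\<gamma> t}) \<and>
     (\<forall>t\<in>{0..1}. \<exists>\<delta>>0. \<forall>u\<in>{0..1}. \<bar>u - t\<bar> < \<delta> \<longrightarrow>
        (\<forall>\<^sub>F z in nhds (\<gamma> u). F u z = F t z))"

definition abel_solution_near ::
    "complex poly \<Rightarrow> complex poly \<Rightarrow> complex \<Rightarrow> complex \<Rightarrow> (complex \<Rightarrow> complex) \<Rightarrow> bool" where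
  "abel_solution_near p q a w y \<longleftrightarrow>
     y a = w \<and>
     (\<forall>\<^sub>F x in nhds a.
        (y has_field_derivative (poly p x * y x ^ 2 + poly q x * y x ^ 3)) (at x))"

text \<open>
  \<open>Y\<close> continues, along \<open>s\<close>, the solution that takes the value \<open>w\<close> at the start of \<open>s\<close>. Such a
  \<open>Y\<close> exists iff the continued solution is regular at each point of \<open>s\<close>, both endpoints included
  (poles and branch points are both excluded).
\<close>

definition abel_continuation ::
    "complex poly \<Rightarrow> complex poly \<Rightarrow> (real \<Rightarrow> complex) \<Rightarrow> complex \<Rightarrow> (real \<Rightarrow> complex \<Rightarrow> complex) \<Rightarrow> bool" where
  "abel_continuation p q s w Y \<longleftrightarrow>
     analytic_continuation_along s Y \<and> abel_solution_near p q (pathstart s) w (Y 0)"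

text \<open>
  \<open>\<phi>\<close> represents the germ at \<open>w\<^sub>0\<close> of the Poincare mapping along \<open>s\<close>. In particular, all solutions
  with initial value close to \<open>w\<^sub>0\<close> are required to be continuable along the whole of \<open>s\<close>. The
  continued value does not depend on the choice of \<open>Y\<close>, by uniqueness of solutions and of analytic
  continuation, so this relation determines the germ of \<open>\<phi>\<close> at \<open>w\<^sub>0\<close>.
\<close>

definition poincare_germ ::
    "complex poly \<Rightarrow> complex poly \<Rightarrow> (real \<Rightarrow> complex) \<Rightarrow> complex \<Rightarrow> (complex \<Rightarrow> complex) \<Rightarrow> bool" where
  "poincare_germ p q s w\<^sub>0 \<phi> \<longleftrightarrow>
     (\<forall>\<^sub>F w in nhds w\<^sub>0. \<exists>Y. abel_continuation p q s w Y \<and> \<phi> w = Y 1 (pathfinish s))"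

end

theory Submission
  imports Defs
begin

text \<open>
  The local existence radius of the Abel equation is uniform as long as base points and initial
  values stay in compact sets. Hence a solution that is regular along a path \<open>\<gamma>\<close> is described by a
  finite chain of local flows centred at points of \<open>\<gamma>\<close>. The same chain continues every solution with
  a nearby initial value along every path close to \<open>\<gamma>\<close> with the same endpoints, and its last value is
  holomorphic in the initial value. So each \<open>t\<close> comes with a holomorphic function near \<open>\<sigma> t\<close> that is
  the Poincare mapping along all \<open>S u\<close> with \<open>u\<close> near \<open>t\<close>. These functions are compatible, hence they
  form an analytic continuation along \<open>\<sigma>\<close>, which is unique by the identity theorem.
\<close>

section \<open>Local solutions of the Abel equation\<close>

text \<open>Picard iteration on a complex disc, with primitives in place of integrals.
  \<open>K * r \<le> B\<close> keeps every iterate within distance \<open>B\<close> of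
  \<open>v\<close>, and \<open>L * r \<le> 1 / 2\<close> makes successive differences decay
  geometrically. Holomorphy is required of the compositions \<open>f x (y x)\<close>, which is what
  the existence of a primitive asks for.\<close>

lemma picard_lindeloef_complex:
  fixes f :: "complex \<Rightarrow> complex \<Rightarrow> complex"
  assumes r: "r > 0" and B0: "B \<ge> 0" and L0: "L \<ge> 0"
    and hol: "\<And>y. y holomorphic_on ball c r \<Longrightarrow> (\<lambda>x. f x (y x)) holomorphic_on ball c r"
    and bound: "\<And>x y. x \<in> ball c r \<Longrightarrow> y \<in> cball v B \<Longrightarrow> norm (f x y) \<le> K"
    and lipschitz: "\<And>x y z. x \<in> ball c r \<Longrightarrow> y \<in> cball v B \<Longrightarrow> z \<in> cball v B \<Longrightarrow>
      norm (f x y - f x z) \<le> L * norm (y - z)"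
    and rK: "K * r \<le> B" and rL: "L * r \<le> 1 / 2"
  obtains y where "y c = v"
    and "\<And>x. x \<in> ball c r \<Longrightarrow> (y has_field_derivative f x (y x)) (at x)"
    and "\<And>x. x \<in> ball c r \<Longrightarrow> y x \<in> cball v B"
proof -
  let ?D = "ball c r"
  define good where "good y \<longleftrightarrow> y holomorphic_on ?D \<and> y ` ?D \<subseteq> cball v B" for y
  have c: "c \<in> ?D" using r by simp
  have K0: "K \<ge> 0"
    using order_trans[OF norm_ge_zero bound[OF c, of v]] B0 by simp
  \<comment> \<open>The implication under the quantifier allows one Picard step to be chosen for
    every \<open>y\<close>, which yields an operator \<open>T\<close> specified on good
    functions.\<close>
  have "\<exists>z. good y \<longrightarrow> good z \<and> z c = v \<and>
      (\<forall>x\<in>?D. (z has_field_derivative f x (y x)) (at x within ?D))" for y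
  proof (cases "good y")
    case True
    then obtain g where g: "\<And>x. x \<in> ?D \<Longrightarrow> (g has_field_derivative f x (y x)) (at x within ?D)"
      using holomorphic_convex_primitive'[OF convex_ball open_ball hol] unfolding good_def by blast
    define z where "z x = g x - g c + v" for x
    have z: "(z has_field_derivative f x (y x)) (at x within ?D)" if "x \<in> ?D" for x
      unfolding z_def using g[OF that] by (auto intro!: derivative_eq_intros)
    have "norm (z x - z c) \<le> K * norm (x - c)" if "x \<in> ?D" for x
      using field_differentiable_bound[OF convex_ball z, of K x c] True bound c that
      unfolding good_def by blast
    moreover have "K * norm (x - c) \<le> K * r" if "x \<in> ?D" for x
      using that K0 by (intro mult_left_mono) (auto simp: dist_norm norm_minus_commute)
    ultimately have "norm (z x - v) \<le> B" if "x \<in> ?D" for x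
      using that rK z_def by fastforce
    moreover have "z holomorphic_on ?D"
      using z by (metis field_differentiable_def holomorphic_on_def)
    ultimately have "good z" by (auto simp: good_def dist_norm norm_minus_commute)
    then show ?thesis using z by (intro exI[of _ z]) (simp add: z_def)
  qed auto
  then obtain T where T: "\<And>y. good y \<Longrightarrow> good (T y)" "\<And>y. good y \<Longrightarrow> T y c = v"
      "\<And>y x. good y \<Longrightarrow> x \<in> ?D \<Longrightarrow> (T y has_field_derivative f x (y x)) (at x within ?D)"
    by metis
  define Y where "Y n = (T ^^ n) (\<lambda>_. v)" for n
  have Y0: "good (\<lambda>_. v)" using B0 by (auto simp: good_def)
  have Yg: "good (Y n)" for n
    by (induction n) (auto simp: Y_def Y0 T(1))
  have Y_0: "Y 0 = (\<lambda>_. v)" by (simp add: Y_def)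
  have YS: "Y (Suc n) = T (Y n)" for n by (simp add: Y_def)
  have Yc: "Y n c = v" for n
    using T(2)[OF Yg] by (cases n) (simp_all add: YS, simp add: Y_def)
  have Yd: "(Y (Suc n) has_field_derivative f x (Y n x)) (at x within ?D)" if "x \<in> ?D" for n x
    using T(3)[OF Yg that] by (simp add: YS)
  have Yin: "Y n x \<in> cball v B" if "x \<in> ?D" for n x
    using Yg[of n] that unfolding good_def by blast
  \<comment> \<open>All iterates equal \<open>v\<close> at \<open>c\<close>, so a difference of
    iterates is bounded through its derivative, which is at most \<open>L\<close> times the previous
    difference. Each step thus gains the factor \<open>L * r \<le> 1 / 2\<close>.\<close>
  have diff: "norm (Y (Suc n) x - Y n x) \<le> B * (1/2) ^ n" if "x \<in> ?D" for n x
    using that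
  proof (induction n arbitrary: x)
    case 0
    then show ?case using Yin[of x 1] by (simp add: Y_def dist_norm norm_minus_commute)
  next
    case (Suc n)
    have d: "((\<lambda>x. Y (Suc (Suc n)) x - Y (Suc n) x) has_field_derivative
        f z (Y (Suc n) z) - f z (Y n z)) (at z within ?D)" if "z \<in> ?D" for z
      using DERIV_diff[OF Yd[OF that] Yd[OF that]] .
    have b: "norm (f z (Y (Suc n) z) - f z (Y n z)) \<le> L * (B * (1/2) ^ n)" if "z \<in> ?D" for z
      using lipschitz[OF that Yin[OF that] Yin[OF that]] Suc.IH[OF that] L0
      by (meson mult_left_mono order_trans)
    have "norm ((Y (Suc (Suc n)) x - Y (Suc n) x) - (Y (Suc (Suc n)) c - Y (Suc n) c))
        \<le> L * (B * (1/2) ^ n) * norm (x - c)"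
      using field_differentiable_bound[OF convex_ball d b Suc.prems c] .
    also have "\<dots> \<le> L * (B * (1/2) ^ n) * r"
      using Suc.prems L0 B0 by (intro mult_left_mono) (auto simp: dist_norm norm_minus_commute)
    also have "\<dots> = (L * r) * (B * (1/2) ^ n)" by simp
    also have "\<dots> \<le> 1 / 2 * (B * (1/2) ^ n)"
      using rL B0 by (intro mult_right_mono) auto
    finally show ?case by (simp add: Yc)
  qed
  have "summable (\<lambda>n. B * (1/2) ^ n)" by (intro summable_mult summable_geometric) auto
  \<comment> \<open>The telescoping series of differences converges by the M-test, and its partial
    sums plus \<open>v\<close> are the iterates themselves.\<close>
  then have "uniform_limit ?D (\<lambda>n x. \<Sum>i<n. Y (Suc i) x - Y i x)
      (\<lambda>x. \<Sum>i. Y (Suc i) x - Y i x) sequentially"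
    using diff by (intro Weierstrass_m_test) auto
  then have "uniform_limit ?D (\<lambda>n x. (\<Sum>i<n. Y (Suc i) x - Y i x) + v)
      (\<lambda>x. (\<Sum>i. Y (Suc i) x - Y i x) + v) sequentially"
    by (intro uniform_limit_add uniform_limit_const)
  moreover have "(\<lambda>n x. (\<Sum>i<n. Y (Suc i) x - Y i x) + v) = Y"
  proof (intro ext)
    show "(\<Sum>i<n. Y (Suc i) x - Y i x) + v = Y n x" for n x
      using sum_lessThan_telescope[of "\<lambda>n. Y n x" n] by (simp add: Y_0)
  qed
  moreover define y where "y = (\<lambda>x. (\<Sum>i. Y (Suc i) x - Y i x) + v)"
  ultimately have lim: "uniform_limit ?D Y y sequentially"
    by (simp only: y_def)
  have pt: "(\<lambda>n. Y n x) \<longlonglongrightarrow> y x" if "x \<in> ?D" for x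
    using tendsto_uniform_limitI[OF lim that] .
  have yin: "y x \<in> cball v B" if "x \<in> ?D" for x
    using Lim_in_closed_set[OF closed_cball _ _ pt[OF that]] Yin[OF that] by auto
  have conv: "\<exists>N. \<forall>n x. n \<ge> N \<longrightarrow> x \<in> ?D \<longrightarrow> norm (f x (Y n x) - f x (y x)) \<le> e" if "e > 0" for e
  proof -
    \<comment> \<open>\<open>L + 1\<close> instead of \<open>L\<close> keeps the divisor positive
      when \<open>L = 0\<close>.\<close>
    have "e / (L + 1) > 0" using that L0 by simp
    then obtain N where N: "\<And>n x. n \<ge> N \<Longrightarrow> x \<in> ?D \<Longrightarrow> dist (Y n x) (y x) < e / (L + 1)"
      using lim unfolding uniform_limit_iff eventually_sequentially by blast
    have "norm (f x (Y n x) - f x (y x)) \<le> e" if "n \<ge> N" "x \<in> ?D" for n x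
    proof -
      have "norm (f x (Y n x) - f x (y x)) \<le> L * norm (Y n x - y x)"
        using lipschitz that Yin yin by blast
      also have "\<dots> \<le> (L + 1) * (e / (L + 1))"
        using N[OF that] L0 by (intro mult_mono) (auto simp: dist_norm)
      finally show ?thesis using L0 by simp
    qed
    then show ?thesis by blast
  qed
  \<comment> \<open>\<open>Y (Suc n)\<close> has derivative \<open>f x (Y n x)\<close>, and these
    derivatives converge uniformly to \<open>f x (y x)\<close>, so the limit is differentiable with
    that derivative. The limit comes as a new function \<open>g\<close>, which agrees with
    \<open>y\<close> on the disc.\<close>
  have "\<exists>g. \<forall>x\<in>?D. ((\<lambda>n. Y (Suc n) x) \<longlonglongrightarrow> g x) \<and>
      (g has_field_derivative f x (y x)) (at x within ?D)"
  proof (rule has_complex_derivative_sequence[OF convex_ball Yd conv])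
    show "\<exists>x l. x \<in> ?D \<and> (\<lambda>n. Y (Suc n) x) \<longlonglongrightarrow> l"
      using c LIMSEQ_Suc[OF pt[OF c]] by blast
  qed
  then obtain g where g: "\<And>x. x \<in> ?D \<Longrightarrow> (\<lambda>n. Y (Suc n) x) \<longlonglongrightarrow> g x"
      "\<And>x. x \<in> ?D \<Longrightarrow> (g has_field_derivative f x (y x)) (at x within ?D)"
    by blast
  have gy: "g x = y x" if "x \<in> ?D" for x
    using g(1)[OF that] LIMSEQ_Suc[OF pt[OF that]] LIMSEQ_unique by blast
  show thesis
  proof (rule that)
    have "Y (Suc n) c = v" for n by (rule Yc)
    then show "g c = v" using g(1)[OF c] by (simp add: LIMSEQ_const_iff)
  next
    fix x assume x: "x \<in> ?D"
    show "(g has_field_derivative f x (g x)) (at x)"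
      using g(2)[OF x] at_within_open[OF x open_ball] gy[OF x] by simp
    show "g x \<in> cball v B"
      using yin[OF x] gy[OF x] by simp
  qed
qed

section \<open>Comparison of two solutions and dependence on the initial value\<close>

abbreviation abel_rhs :: "complex poly \<Rightarrow> complex poly \<Rightarrow> complex \<Rightarrow> complex \<Rightarrow> complex" where
  "abel_rhs p q x y \<equiv> poly p x * y ^ 2 + poly q x * y ^ 3"

text \<open>
  The difference of two solutions solves a linear equation. With \<open>y c = z c\<close> the formula gives
  uniqueness; dividing by \<open>y c - z c\<close> and letting \<open>z\<close> tend to \<open>y\<close>, it gives complex
  differentiability in the initial value.
\<close>

lemma abel_difference:
  assumes U: "convex U" "open U" "c \<in> U"
    and y: "\<And>x. x \<in> U \<Longrightarrow> (y has_field_derivative abel_rhs p q x (y x)) (at x)"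
    and z: "\<And>x. x \<in> U \<Longrightarrow> (z has_field_derivative abel_rhs p q x (z x)) (at x)"
  shows "\<exists>G. G c = 0 \<and> (\<forall>x\<in>U. (G has_field_derivative
      poly p x * (y x + z x) + poly q x * (y x ^ 2 + y x * z x + z x ^ 2)) (at x)) \<and>
      (\<forall>x\<in>U. y x - z x = (y c - z c) * exp (G x))"
proof -
  let ?g = "\<lambda>x. poly p x * (y x + z x) + poly q x * (y x ^ 2 + y x * z x + z x ^ 2)"
  have "y holomorphic_on U" "z holomorphic_on U"
    using y z by (auto simp: holomorphic_on_open[OF U(2)])
  then have "?g holomorphic_on U"
    by (intro holomorphic_intros)
  then obtain H where H: "\<And>x. x \<in> U \<Longrightarrow> (H has_field_derivative ?g x) (at x within U)"
    using holomorphic_convex_primitive'[OF U(1,2)] by blast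
  define G where "G x = H x - H c" for x
  have G: "(G has_field_derivative ?g x) (at x)" if "x \<in> U" for x
    using H[OF that] unfolding G_def at_within_open[OF that U(2)]
    by (auto intro!: derivative_eq_intros)
  \<comment> \<open>\<open>exp (- G x)\<close> is an integrating factor: \<open>y - z\<close> has
    derivative \<open>(y - z) * ?g\<close>, so \<open>h\<close> is constant.\<close>
  define h where "h x = (y x - z x) * exp (- G x)" for x
  have h: "(h has_field_derivative 0) (at x within U)" if "x \<in> U" for x
    unfolding h_def
    by (rule has_field_derivative_at_within)
      (auto intro!: derivative_eq_intros y z G that
        simp: power2_eq_square power3_eq_cube algebra_simps)
  have "y x - z x = (y c - z c) * exp (G x)" if "x \<in> U" for x
  proof -
    have "norm (h x - h c) \<le> 0 * norm (x - c)"
      by (rule field_differentiable_bound[OF U(1) h]) (use that U in auto)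
    then have "(y x - z x) * exp (- G x) = y c - z c"
      by (simp add: h_def G_def)
    then show ?thesis by (simp add: exp_minus field_simps)
  qed
  then show ?thesis using G by (intro exI[of _ G]) (auto simp: G_def)
qed

lemma abel_unique:
  assumes U: "convex U" "open U" "c \<in> U"
    and "\<And>x. x \<in> U \<Longrightarrow> (y has_field_derivative abel_rhs p q x (y x)) (at x)"
    and "\<And>x. x \<in> U \<Longrightarrow> (z has_field_derivative abel_rhs p q x (z x)) (at x)"
    and "y c = z c" "x \<in> U"
  shows "y x = z x"
  using abel_difference[OF assms(1-5)] assms(6,7) by auto

lemma poly_bounded_on_ball:
  fixes p :: "complex poly"
  obtains A where "A \<ge> 0" "\<And>x. x \<in> ball c r \<Longrightarrow> norm (poly p x) \<le> A"
proof -
  have "compact (poly p ` cball c r)"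
    by (intro compact_continuous_image continuous_intros compact_cball)
  then obtain A where "\<forall>x\<in>cball c r. norm (poly p x) \<le> A"
    using compact_imp_bounded bounded_iff by (metis imageI)
  then show thesis by (intro that[of "max A 0"]) (auto simp: le_max_iff_disj)
qed

text \<open>The expression is the difference quotient of the right-hand side in its second argument.
  The bound serves twice: as a Lipschitz constant for the existence proof and as a bound on the
  derivative of the exponent \<open>G\<close> that compares two solutions.\<close>

lemma abel_quotient_bound:
  fixes P Q y z :: complex
  assumes P: "norm P \<le> A" and Q: "norm Q \<le> B" and y: "norm y \<le> M" and z: "norm z \<le> M"
  shows "norm (P * (y + z) + Q * (y ^ 2 + y * z + z ^ 2)) \<le> A * (2 * M) + B * (3 * M ^ 2)"
proof -
  have nonneg: "0 \<le> A" "0 \<le> B" "0 \<le> M"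
    using assms norm_ge_zero order_trans by blast+
  have "norm (y + z) \<le> M + M"
    using y z by (rule norm_triangle_mono)
  moreover have "norm (y ^ 2 + y * z + z ^ 2) \<le> M ^ 2 + M * M + M ^ 2"
    by (intro norm_triangle_mono)
      (use y z nonneg in \<open>simp_all add: norm_mult norm_power power_mono mult_mono\<close>)
  ultimately show ?thesis
    by (intro norm_triangle_mono)
      (use P Q nonneg in \<open>auto simp: norm_mult power2_eq_square intro!: mult_mono\<close>)
qed

text \<open>The difference quotient in the initial value is exactly \<open>exp (G v w x0)\<close>.
  As \<open>v\<close> tends to \<open>w\<close> it tends to \<open>exp (G w w x0)\<close>, where
  \<open>G w w\<close> is a primitive of \<open>2 p y + 3 q y^2\<close>: the solution of the
  variational equation.\<close>

lemma abel_holomorphic_in_initial_value: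
  assumes V: "open V" and r: "r > 0"
    and init: "\<And>v. v \<in> V \<Longrightarrow> y v c = v"
    and sol: "\<And>v x. v \<in> V \<Longrightarrow> x \<in> ball c r \<Longrightarrow>
      (y v has_field_derivative abel_rhs p q x (y v x)) (at x)"
    and M: "\<And>v x. v \<in> V \<Longrightarrow> x \<in> ball c r \<Longrightarrow> norm (y v x) \<le> M"
    and x0: "x0 \<in> ball c r"
  shows "(\<lambda>v. y v x0) holomorphic_on V"
proof -
  have c: "c \<in> ball c r" using r by simp
  obtain A where A: "A \<ge> 0" "\<And>x. x \<in> ball c r \<Longrightarrow> norm (poly p x) \<le> A"
    using poly_bounded_on_ball by blast
  obtain B where B: "B \<ge> 0" "\<And>x. x \<in> ball c r \<Longrightarrow> norm (poly q x) \<le> B"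
    using poly_bounded_on_ball by blast
  let ?g = "\<lambda>v w x. poly p x * (y v x + y w x) + poly q x * (y v x ^ 2 + y v x * y w x + y w x ^ 2)"
  \<comment> \<open>\<open>L\<close> bounds the derivative of every \<open>G v w\<close>, hence
    \<open>E\<close> bounds \<open>exp (G v w x)\<close>, the Lipschitz factor of the flow.
    \<open>C\<close> is the resulting Lipschitz constant of \<open>G v w x0\<close> in
    \<open>v\<close> at \<open>w\<close>.\<close>
  define L where "L = A * (2 * M) + B * (3 * M ^ 2)"
  define E where "E = exp (L * r)"
  define C where "C = E * (A + B * (3 * M)) * r"
  define good where "good v w G \<longleftrightarrow> G c = 0 \<and>
      (\<forall>x\<in>ball c r. (G has_field_derivative ?g v w x) (at x)) \<and>
      (\<forall>x\<in>ball c r. y v x - y w x = (v - w) * exp (G x))" for v w G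
  have "\<exists>G. good v w G" if vw: "v \<in> V" "w \<in> V" for v w
    using abel_difference[OF convex_ball open_ball c sol[OF vw(1)] sol[OF vw(2)]] init vw
    by (simp add: good_def)
  then obtain G where G: "\<And>v w. v \<in> V \<Longrightarrow> w \<in> V \<Longrightarrow> good v w (G v w)"
    by metis
  have G0: "G v w c = 0" if "v \<in> V" "w \<in> V" for v w
    using G[OF that] by (simp add: good_def)
  have Gd: "(G v w has_field_derivative ?g v w x) (at x)"
    if "v \<in> V" "w \<in> V" "x \<in> ball c r" for v w x
    using G[OF that(1,2)] that(3) unfolding good_def by blast
  have Gy: "y v x - y w x = (v - w) * exp (G v w x)"
    if "v \<in> V" "w \<in> V" "x \<in> ball c r" for v w x
    using G[OF that(1,2)] that(3) unfolding good_def by blast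
  have from_centre: "norm (h x - h c) \<le> K * r"
    if "\<And>x. x \<in> ball c r \<Longrightarrow> (h has_field_derivative h' x) (at x)"
      "\<And>x. x \<in> ball c r \<Longrightarrow> norm (h' x) \<le> K" "x \<in> ball c r" for h h' K x
  proof -
    have "norm (h x - h c) \<le> K * norm (x - c)"
      using that c
      by (intro field_differentiable_bound[OF convex_ball, of c r h h' K])
        (auto intro: has_field_derivative_at_within)
    also have "\<dots> \<le> K * r"
      using that(3) order_trans[OF norm_ge_zero that(2)[OF c]]
      by (intro mult_left_mono) (auto simp: dist_norm norm_minus_commute)
    finally show ?thesis .
  qed
  have Lip: "norm (y v x - y w x) \<le> norm (v - w) * E"
    if vw: "v \<in> V" "w \<in> V" and x: "x \<in> ball c r" for v w x
  proof -
    have "norm (?g v w x) \<le> L" if "x \<in> ball c r" for x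
      unfolding L_def by (intro abel_quotient_bound A B M vw that)
    from from_centre[OF Gd[OF vw] this x] have "norm (G v w x) \<le> L * r"
      using G0[OF vw] by simp
    then have "norm (exp (G v w x)) \<le> E"
      unfolding E_def by (meson exp_le_cancel_iff norm_exp order_trans)
    then show ?thesis
      by (simp add: Gy[OF vw x] norm_mult mult_left_mono)
  qed
  have close: "norm (G v w x0 - G w w x0) \<le> C * norm (v - w)" if vw: "v \<in> V" "w \<in> V" for v w
  proof -
    have d: "((\<lambda>x. G v w x - G w w x) has_field_derivative ?g v w x - ?g w w x) (at x)"
      if "x \<in> ball c r" for x
      by (intro DERIV_diff Gd vw that)
    have b: "norm (?g v w x - ?g w w x) \<le> norm (v - w) * E * (A + B * (3 * M))"
      if x: "x \<in> ball c r" for x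
    proof -
      \<comment> \<open>Pulling out \<open>y v x - y w x\<close> makes the difference of the two
        derivatives small with \<open>v - w\<close>, by the Lipschitz estimate
        \<open>Lip\<close>.\<close>
      have "?g v w x - ?g w w x = (y v x - y w x) * (poly p x + poly q x * (y v x + 2 * y w x))"
        by (simp add: power2_eq_square algebra_simps)
      also have "norm \<dots> \<le> norm (v - w) * E * (A + B * (3 * M))"
      proof -
        have "norm (y v x + 2 * y w x) \<le> M + 2 * M"
          using M[OF vw(1) x] M[OF vw(2) x] by (intro norm_triangle_mono) (auto simp: norm_mult)
        then have "norm (poly q x * (y v x + 2 * y w x)) \<le> B * (3 * M)"
          unfolding norm_mult using B(2)[OF x] B(1) by (intro mult_mono) auto
        then have "norm (poly p x + poly q x * (y v x + 2 * y w x)) \<le> A + B * (3 * M)"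
          using A(2)[OF x] by (intro norm_triangle_mono)
        then show ?thesis
          unfolding norm_mult[of "y v x - y w x"]
          using Lip[OF vw x] by (intro mult_mono) (auto simp: E_def)
      qed
      finally show ?thesis .
    qed
    show ?thesis
      using from_centre[OF d b x0] G0 vw by (simp add: C_def mult_ac)
  qed
  have "((\<lambda>v. y v x0) has_field_derivative exp (G w w x0)) (at w)" if w: "w \<in> V" for w
  proof -
    have inV: "\<forall>\<^sub>F v in at w. v \<in> V" using V w by (rule eventually_at_in_open')
    have "((\<lambda>v. G v w x0 - G w w x0) \<longlongrightarrow> 0) (at w)"
    proof (rule Lim_null_comparison)
      show "\<forall>\<^sub>F v in at w. norm (G v w x0 - G w w x0) \<le> C * norm (v - w)"
        using inV by eventually_elim (use close w in auto)
      show "((\<lambda>v. C * norm (v - w)) \<longlongrightarrow> 0) (at w)"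
        by (auto intro!: tendsto_eq_intros)
    qed
    then have "((\<lambda>v. exp (G v w x0)) \<longlongrightarrow> exp (G w w x0)) (at w)"
      by (intro tendsto_exp) (rule LIM_zero_cancel)
    moreover have "\<forall>\<^sub>F v in at w. exp (G v w x0) = (y v x0 - y w x0) / (v - w)"
      using inV eventually_neq_at_within[of w w UNIV]
      by eventually_elim (simp add: Gy[OF _ w x0])
    ultimately show ?thesis
      unfolding has_field_derivative_iff using Lim_transform_eventually by fast
  qed
  then show ?thesis by (auto simp: holomorphic_on_open[OF V])
qed

text \<open>One radius \<open>r\<close> serves all centres and initial values, because the bounds in
  the Picard argument depend only on \<open>R\<close> and \<open>M\<close>: every disc lies in
  \<open>ball 0 (R + 1)\<close>, and every solution moves at most 1 away from its initial
  value.\<close>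

lemma abel_local_flow:
  fixes R M :: real
  assumes "M \<ge> 0"
  obtains r sol where "r > 0"
    and "\<And>c v. norm c \<le> R \<Longrightarrow> norm v < M \<Longrightarrow> sol c v c = v"
    and "\<And>c v x. norm c \<le> R \<Longrightarrow> norm v < M \<Longrightarrow> x \<in> ball c r \<Longrightarrow>
      (sol c v has_field_derivative abel_rhs p q x (sol c v x)) (at x)"
    and "\<And>c x. norm c \<le> R \<Longrightarrow> x \<in> ball c r \<Longrightarrow> (\<lambda>v. sol c v x) holomorphic_on ball 0 M"
proof -
  obtain A where A: "A \<ge> 0" "\<And>x. x \<in> ball 0 (R + 1) \<Longrightarrow> norm (poly p x) \<le> A"
    using poly_bounded_on_ball by blast
  obtain B where B: "B \<ge> 0" "\<And>x. x \<in> ball 0 (R + 1) \<Longrightarrow> norm (poly q x) \<le> B"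
    using poly_bounded_on_ball by blast
  define N where "N = M + 1"
  have N: "N \<ge> 0" using assms N_def by simp
  define K where "K = A * N ^ 2 + B * N ^ 3"
  define L where "L = A * (2 * N) + B * (3 * N ^ 2)"
  have KL: "K \<ge> 0" "L \<ge> 0" using A B N by (auto simp: K_def L_def)
  \<comment> \<open>This single choice gives \<open>r \<le> 1\<close>, so that the discs stay in
    \<open>ball 0 (R + 1)\<close>, together with both smallness conditions of the Picard argument
    with \<open>B = 1\<close>.\<close>
  define r where "r = 1 / (1 + K + 2 * L)"
  have r: "r > 0" "r \<le> 1" "K * r \<le> 1" "L * r \<le> 1 / 2"
    using KL by (auto simp: r_def field_simps)
  define good where "good c v y \<longleftrightarrow> y c = v \<and> (\<forall>x\<in>ball c r.
      (y has_field_derivative abel_rhs p q x (y x)) (at x) \<and> norm (y x) \<le> N)" for c v y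
  have "\<exists>y. norm c \<le> R \<longrightarrow> norm v < M \<longrightarrow> good c v y" for c v
  proof (cases "norm c \<le> R \<and> norm v < M")
    case True
    have in_ball: "x \<in> ball 0 (R + 1)" if "x \<in> ball c r" for x
      using that True r(2) norm_triangle_ineq4[of c "c - x"] by (simp add: dist_norm)
    have norm_y: "norm y \<le> N" if "y \<in> cball v 1" for y
      using that True norm_triangle_ineq4[of v "v - y"] by (simp add: dist_norm N_def)
    obtain y where "y c = v"
      and "\<And>x. x \<in> ball c r \<Longrightarrow> (y has_field_derivative abel_rhs p q x (y x)) (at x)"
      and "\<And>x. x \<in> ball c r \<Longrightarrow> y x \<in> cball v 1"
    proof (rule picard_lindeloef_complex[of r 1 L c "abel_rhs p q" v K])
      show "(\<lambda>x. abel_rhs p q x (y x)) holomorphic_on ball c r" if "y holomorphic_on ball c r" for y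
        using that by (intro holomorphic_intros)
    next
      fix x y assume xy: "x \<in> ball c r" "y \<in> cball v 1"
      show "norm (abel_rhs p q x y) \<le> K"
        unfolding K_def
        by (intro norm_triangle_mono)
          (use A B N norm_y[OF xy(2)] in_ball[OF xy(1)] in
            \<open>auto simp: norm_mult norm_power intro!: mult_mono power_mono\<close>)
    next
      fix x y z assume xyz: "x \<in> ball c r" "y \<in> cball v 1" "z \<in> cball v 1"
      have "abel_rhs p q x y - abel_rhs p q x z =
          (poly p x * (y + z) + poly q x * (y ^ 2 + y * z + z ^ 2)) * (y - z)"
        by (simp add: power2_eq_square power3_eq_cube algebra_simps)
      also have "norm \<dots> \<le> L * norm (y - z)"
        unfolding norm_mult L_def
        by (intro mult_right_mono abel_quotient_bound A B norm_y in_ball xyz norm_ge_zero)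
      finally show "norm (abel_rhs p q x y - abel_rhs p q x z) \<le> L * norm (y - z)" .
    qed (use r KL in auto)
    then show ?thesis using norm_y by (intro exI[of _ y]) (simp add: good_def)
  qed auto
  then obtain sol where "\<And>c v. norm c \<le> R \<Longrightarrow> norm v < M \<Longrightarrow> good c v (sol c v)"
    by metis
  then have sol: "sol c v c = v"
    "x \<in> ball c r \<Longrightarrow> (sol c v has_field_derivative abel_rhs p q x (sol c v x)) (at x)"
    "x \<in> ball c r \<Longrightarrow> norm (sol c v x) \<le> N"
    if "norm c \<le> R" "norm v < M" for c v x
    using that unfolding good_def by blast+
  have hol: "(\<lambda>v. sol c v x) holomorphic_on ball 0 M" if c: "norm c \<le> R" and x: "x \<in> ball c r" for c x
    by (rule abel_holomorphic_in_initial_value[OF open_ball r(1) sol(1)[OF c] sol(2)[OF c] sol(3)[OF c] x])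
      auto
  show thesis
    by (rule that[OF r(1) sol(1,2) hol])
qed

section \<open>Uniqueness of continuation along a path\<close>

text \<open>The parameter set is arbitrary so that a continuation can be restricted to a piece of
  the path and compared there with a single local flow.\<close>

definition continuation_on :: "real set \<Rightarrow> (real \<Rightarrow> complex) \<Rightarrow> (real \<Rightarrow> complex \<Rightarrow> complex) \<Rightarrow> bool"
  where "continuation_on I \<gamma> F \<longleftrightarrow>
    (\<forall>t\<in>I. F t analytic_on {\<gamma> t}) \<and>
    (\<forall>t\<in>I. \<exists>\<delta>>0. \<forall>u\<in>I. \<bar>u - t\<bar> < \<delta> \<longrightarrow> (\<forall>\<^sub>F z in nhds (\<gamma> u). F u z = F t z))"

lemma analytic_continuation_along_iff:
  "analytic_continuation_along \<gamma> F \<longleftrightarrow> continuation_on {0..1} \<gamma> F"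
  by (simp add: analytic_continuation_along_def continuation_on_def)

lemma continuation_on_subset: "continuation_on I \<gamma> F \<Longrightarrow> J \<subseteq> I \<Longrightarrow> continuation_on J \<gamma> F"
  unfolding continuation_on_def by (meson subsetD)

lemma continuation_on_const:
  assumes "f holomorphic_on U" "open U" "\<gamma> ` I \<subseteq> U"
  shows "continuation_on I \<gamma> (\<lambda>_. f)"
  using assms zero_less_one unfolding continuation_on_def analytic_at image_subset_iff
  by (auto intro: gt_ex)

lemma holomorphic_eq_on_ball:
  assumes "f holomorphic_on ball c r" "g holomorphic_on ball c r" "z \<in> ball c r"
    and "\<forall>\<^sub>F x in nhds z. f x = g x" and "x \<in> ball c r"
  shows "f x = g x"
proof -
  obtain S where S: "open S" "z \<in> S" "\<And>x. x \<in> S \<Longrightarrow> f x = g x"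
    using assms(4) unfolding eventually_nhds by blast
  show ?thesis
  proof (rule analytic_continuation_open[of "S \<inter> ball c r" "ball c r" f g x])
    show "S \<inter> ball c r \<noteq> {}" using S(2) assms(3) by blast
  qed (use S assms in auto)
qed

text \<open>By the identity theorem, the right-hand side does not mention \<open>z\<close>.
  Agreement of germs is therefore a condition on the whole disc, the same at each of its
  points.\<close>

lemma eventually_nhds_eq_iff:
  assumes "f holomorphic_on ball c r" "g holomorphic_on ball c r" "z \<in> ball c r"
  shows "(\<forall>\<^sub>F x in nhds z. f x = g x) \<longleftrightarrow> (\<forall>x\<in>ball c r. f x = g x)"
proof
  assume "\<forall>x\<in>ball c r. f x = g x"
  then show "\<forall>\<^sub>F x in nhds z. f x = g x"
    using eventually_nhds_in_open[OF open_ball assms(3)] by (auto elim: eventually_mono)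
qed (use holomorphic_eq_on_ball[OF assms] in blast)

text \<open>Agreement of the two germs is locally constant in the parameter: near \<open>t\<close>
  they are the germs of \<open>F t\<close> and \<open>G t\<close>, which are holomorphic on a common
  disc. Connectedness of \<open>I\<close> carries the agreement from \<open>a\<close> to
  \<open>b\<close>.\<close>

lemma continuation_unique:
  assumes F: "continuation_on I \<gamma> F" and G: "continuation_on I \<gamma> G"
    and I: "connected I" and \<gamma>: "continuous_on I \<gamma>" and ab: "a \<in> I" "b \<in> I"
    and init: "\<forall>\<^sub>F z in nhds (\<gamma> a). F a z = G a z"
  shows "\<forall>\<^sub>F z in nhds (\<gamma> b). F b z = G b z"
proof (rule connected_induction_simple[where P = "\<lambda>t. \<forall>\<^sub>F z in nhds (\<gamma> t). F t z = G t z", OF I ab init])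
  fix t assume t: "t \<in> I"
  obtain d where d: "d > 0" "F t holomorphic_on ball (\<gamma> t) d"
    using F t unfolding continuation_on_def analytic_at_ball by blast
  obtain e where e: "e > 0" "G t holomorphic_on ball (\<gamma> t) e"
    using G t unfolding continuation_on_def analytic_at_ball by blast
  obtain d' where d': "d' > 0" "\<And>u. u \<in> I \<Longrightarrow> \<bar>u - t\<bar> < d' \<Longrightarrow> \<forall>\<^sub>F z in nhds (\<gamma> u). F u z = F t z"
    using F t unfolding continuation_on_def by blast
  obtain e' where e': "e' > 0" "\<And>u. u \<in> I \<Longrightarrow> \<bar>u - t\<bar> < e' \<Longrightarrow> \<forall>\<^sub>F z in nhds (\<gamma> u). G u z = G t z"
    using G t unfolding continuation_on_def by blast
  define r where "r = min d e"
  have hol: "F t holomorphic_on ball (\<gamma> t) r" "G t holomorphic_on ball (\<gamma> t) r"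
    using d e by (auto simp: r_def intro: holomorphic_on_subset)
  have r: "r > 0" using d e by (simp add: r_def)
  obtain k where k: "k > 0" "\<And>u. u \<in> I \<Longrightarrow> dist u t < k \<Longrightarrow> dist (\<gamma> u) (\<gamma> t) < r"
    using \<gamma> t r unfolding continuous_on_iff by blast
  \<comment> \<open>For \<open>u\<close> in \<open>T\<close>, the point \<open>\<gamma> u\<close>
    lies in the common disc (by \<open>k\<close>), and \<open>F u\<close>, \<open>G u\<close> have
    the germs of \<open>F t\<close>, \<open>G t\<close> there (by \<open>d'\<close>,
    \<open>e'\<close>).\<close>
  define T where "T = I \<inter> ball t (min k (min d' e'))"
  have iff: "(\<forall>\<^sub>F z in nhds (\<gamma> u). F u z = G u z) \<longleftrightarrow> (\<forall>z\<in>ball (\<gamma> t) r. F t z = G t z)"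
    if u: "u \<in> T" for u
  proof -
    have u': "u \<in> I" "dist u t < k" "\<bar>u - t\<bar> < d'" "\<bar>u - t\<bar> < e'"
      using u by (auto simp: T_def dist_real_def)
    have "(\<forall>\<^sub>F z in nhds (\<gamma> u). F u z = G u z) \<longleftrightarrow> (\<forall>\<^sub>F z in nhds (\<gamma> u). F t z = G t z)"
    proof
      assume "\<forall>\<^sub>F z in nhds (\<gamma> u). F u z = G u z"
      with d'(2)[OF u'(1,3)] e'(2)[OF u'(1,4)]
      show "\<forall>\<^sub>F z in nhds (\<gamma> u). F t z = G t z" by eventually_elim simp
    next
      assume "\<forall>\<^sub>F z in nhds (\<gamma> u). F t z = G t z"
      with d'(2)[OF u'(1,3)] e'(2)[OF u'(1,4)]
      show "\<forall>\<^sub>F z in nhds (\<gamma> u). F u z = G u z" by eventually_elim simp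
    qed
    also have "\<dots> \<longleftrightarrow> (\<forall>z\<in>ball (\<gamma> t) r. F t z = G t z)"
      using k(2)[OF u'(1,2)] by (intro eventually_nhds_eq_iff hol) (simp add: dist_commute)
    finally show ?thesis .
  qed
  show "\<exists>T. openin (top_of_set I) T \<and> t \<in> T \<and> (\<forall>x\<in>T. \<forall>y\<in>T.
      (\<forall>\<^sub>F z in nhds (\<gamma> x). F x z = G x z) \<longrightarrow> (\<forall>\<^sub>F z in nhds (\<gamma> y). F y z = G y z))"
  proof (intro exI[of _ T] conjI ballI impI)
    show "openin (top_of_set I) T" unfolding T_def by (intro openin_open_Int open_ball)
    show "t \<in> T" using t k d' e' by (simp add: T_def)
  qed (use iff in blast)
qed

section \<open>Continued solutions of the Abel equation\<close>

lemma abel_solution_near_unique: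
  assumes "abel_solution_near p q c w y" "abel_solution_near p q c w z"
  shows "\<forall>\<^sub>F x in nhds c. y x = z x"
proof -
  have "\<forall>\<^sub>F x in nhds c. (y has_field_derivative abel_rhs p q x (y x)) (at x) \<and>
      (z has_field_derivative abel_rhs p q x (z x)) (at x)"
    using assms unfolding abel_solution_near_def by (simp add: eventually_conj_iff)
  then obtain r where r: "r > 0" "\<And>x. x \<in> ball c r \<Longrightarrow>
      (y has_field_derivative abel_rhs p q x (y x)) (at x) \<and>
      (z has_field_derivative abel_rhs p q x (z x)) (at x)"
    unfolding eventually_nhds_metric by (auto simp: dist_commute)
  have "\<forall>x\<in>ball c r. y x = z x"
    using abel_unique[OF convex_ball open_ball, of c c r y p q z] r assms
    by (auto simp: abel_solution_near_def)
  then show ?thesis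
    using r(1) unfolding eventually_nhds_metric by (auto simp: dist_commute)
qed

lemma abel_continuation_unique:
  assumes "abel_continuation p q \<gamma> w Y" "abel_continuation p q \<gamma> w Z"
    and \<gamma>: "continuous_on {0..1} \<gamma>" and t: "t \<in> {0..1}"
  shows "\<forall>\<^sub>F x in nhds (\<gamma> t). Y t x = Z t x"
proof -
  have near: "abel_solution_near p q (\<gamma> 0) w (Y 0)" "abel_solution_near p q (\<gamma> 0) w (Z 0)"
    and cont: "continuation_on {0..1} \<gamma> Y" "continuation_on {0..1} \<gamma> Z"
    using assms by (auto simp: abel_continuation_def analytic_continuation_along_iff pathstart_def)
  show ?thesis
    by (rule continuation_unique[OF cont _ \<gamma> _ t abel_solution_near_unique[OF near]]) auto
qed

text \<open>Permanence of the differential equation: \<open>deriv (Y t)\<close> and the right-hand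
  side evaluated at \<open>Y t\<close> are both continuations along \<open>\<gamma>\<close>, and
  they have the same germ at the start.\<close>

lemma abel_continuation_solves:
  assumes Y: "abel_continuation p q \<gamma> w Y"
    and \<gamma>: "continuous_on {0..1} \<gamma>" and t: "t \<in> {0..1}"
  shows "abel_solution_near p q (\<gamma> t) (Y t (\<gamma> t)) (Y t)"
proof -
  have near: "abel_solution_near p q (\<gamma> 0) w (Y 0)"
    and cont: "continuation_on {0..1} \<gamma> Y"
    using Y by (auto simp: abel_continuation_def analytic_continuation_along_iff pathstart_def)
  let ?F = "\<lambda>t. deriv (Y t)" and ?G = "\<lambda>t z. abel_rhs p q z (Y t z)"
  have an: "Y t analytic_on {\<gamma> t}" if "t \<in> {0..1}" for t
    using cont that by (simp add: continuation_on_def)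
  have poly: "poly P analytic_on A" for P :: "complex poly" and A
    unfolding analytic_on_holomorphic
    by (intro exI[of _ UNIV]) (auto intro!: holomorphic_intros)
  have F: "continuation_on {0..1} \<gamma> ?F"
    unfolding continuation_on_def
  proof (intro conjI ballI)
    fix t :: real assume t: "t \<in> {0..1}"
    show "?F t analytic_on {\<gamma> t}" using an[OF t] by (rule analytic_deriv)
    obtain d where "d > 0" and d: "\<And>u. u \<in> {0..1} \<Longrightarrow> \<bar>u - t\<bar> < d \<Longrightarrow> \<forall>\<^sub>F z in nhds (\<gamma> u). Y u z = Y t z"
      using cont t unfolding continuation_on_def by blast
    have "\<forall>\<^sub>F z in nhds (\<gamma> u). ?F u z = ?F t z" if "u \<in> {0..1}" "\<bar>u - t\<bar> < d" for u
    proof -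
      \<comment> \<open>Equality near \<open>\<gamma> u\<close> is equality of germs at all points
        near \<open>\<gamma> u\<close>, which is what equality of derivatives there
        requires.\<close>
      have "\<forall>\<^sub>F z in nhds (\<gamma> u). \<forall>\<^sub>F x in nhds z. Y u x = Y t x"
        using d[OF that] by (simp add: eventually_eventually)
      then show ?thesis
        by (rule eventually_mono) (rule deriv_cong_ev, simp_all)
    qed
    then show "\<exists>d>0. \<forall>u\<in>{0..1}. \<bar>u - t\<bar> < d \<longrightarrow> (\<forall>\<^sub>F z in nhds (\<gamma> u). ?F u z = ?F t z)"
      using \<open>d > 0\<close> by blast
  qed
  have G: "continuation_on {0..1} \<gamma> ?G"
    unfolding continuation_on_def
  proof (intro conjI ballI)
    fix t :: real assume t: "t \<in> {0..1}"
    show "?G t analytic_on {\<gamma> t}"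
      by (intro analytic_intros an t poly)
    obtain d where "d > 0" and d: "\<And>u. u \<in> {0..1} \<Longrightarrow> \<bar>u - t\<bar> < d \<Longrightarrow> \<forall>\<^sub>F z in nhds (\<gamma> u). Y u z = Y t z"
      using cont t unfolding continuation_on_def by blast
    have "\<forall>\<^sub>F z in nhds (\<gamma> u). ?G u z = ?G t z" if "u \<in> {0..1}" "\<bar>u - t\<bar> < d" for u
      using d[OF that] by eventually_elim simp
    then show "\<exists>d>0. \<forall>u\<in>{0..1}. \<bar>u - t\<bar> < d \<longrightarrow> (\<forall>\<^sub>F z in nhds (\<gamma> u). ?G u z = ?G t z)"
      using \<open>d > 0\<close> by blast
  qed
  have start: "\<forall>\<^sub>F z in nhds (\<gamma> 0). ?F 0 z = ?G 0 z"
    using near unfolding abel_solution_near_def by (auto elim!: eventually_mono dest: DERIV_imp_deriv)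
  have ode: "\<forall>\<^sub>F z in nhds (\<gamma> t). ?F t z = ?G t z"
    by (rule continuation_unique[OF F G _ \<gamma> _ t start]) auto
  obtain r where r: "r > 0" "Y t holomorphic_on ball (\<gamma> t) r"
    using an[OF t] unfolding analytic_at_ball by blast
  have "\<forall>\<^sub>F z in nhds (\<gamma> t). z \<in> ball (\<gamma> t) r"
    using r(1) by (intro eventually_nhds_in_open) auto
  with ode have "\<forall>\<^sub>F z in nhds (\<gamma> t). (Y t has_field_derivative ?G t z) (at z)"
    by eventually_elim (metis holomorphic_derivI[OF r(2) open_ball])
  then show ?thesis by (simp add: abel_solution_near_def)
qed

text \<open>Near \<open>t\<close> the value at parameter \<open>u\<close> is the fixed function
  \<open>F t\<close> evaluated at \<open>\<gamma> u\<close>. On the unit interval this bounds the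
  values of a solution along its path.\<close>

lemma continuous_on_continuation_values:
  assumes F: "continuation_on I \<gamma> F" and \<gamma>: "continuous_on I \<gamma>"
  shows "continuous_on I (\<lambda>t. F t (\<gamma> t))"
  unfolding continuous_on
proof
  fix t assume t: "t \<in> I"
  obtain d where "d > 0" and d: "\<And>u. u \<in> I \<Longrightarrow> \<bar>u - t\<bar> < d \<Longrightarrow> \<forall>\<^sub>F z in nhds (\<gamma> u). F u z = F t z"
    using F t unfolding continuation_on_def by blast
  have "isCont (F t) (\<gamma> t)"
    using F t unfolding continuation_on_def by (auto intro: analytic_at_imp_isCont)
  then have "((\<lambda>u. F t (\<gamma> u)) \<longlongrightarrow> F t (\<gamma> t)) (at t within I)"
    by (rule isCont_tendsto_compose) (use \<gamma> t in \<open>simp add: continuous_on\<close>)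
  moreover have "\<forall>\<^sub>F u in at t within I. F t (\<gamma> u) = F u (\<gamma> u)"
    unfolding eventually_at
  proof (intro exI conjI ballI impI)
    show "F t (\<gamma> u) = F u (\<gamma> u)" if "u \<in> I" "u \<noteq> t \<and> dist u t < d" for u
      using eventually_nhds_x_imp_x[OF d[OF that(1)]] that(2) by (simp add: dist_real_def)
  qed (fact \<open>d > 0\<close>)
  ultimately show "((\<lambda>u. F u (\<gamma> u)) \<longlongrightarrow> F t (\<gamma> t)) (at t within I)"
    by (rule Lim_transform_eventually)
qed

section \<open>Solutions along nearby paths\<close>

text \<open>The index is that of the last node \<open>k / N\<close> not after \<open>t\<close>; it
  selects the local flow used at \<open>t\<close>. The third claim, used in both directions, says
  that close parameters use the same or adjacent flows.\<close>

lemma floor_index: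
  fixes N :: nat and t u :: real
  assumes "t \<in> {0..1}"
  shows "nat \<lfloor>real N * t\<rfloor> \<le> N"
    and "N > 0 \<Longrightarrow> \<bar>real (nat \<lfloor>real N * t\<rfloor>) / real N - t\<bar> \<le> 1 / real N"
    and "u \<in> {0..1} \<Longrightarrow> N > 0 \<Longrightarrow> \<bar>u - t\<bar> < 1 / real N \<Longrightarrow>
      nat \<lfloor>real N * u\<rfloor> \<le> Suc (nat \<lfloor>real N * t\<rfloor>)"
proof -
  have bnd: "real (nat \<lfloor>real N * s\<rfloor>) \<le> real N * s" "real N * s < real (nat \<lfloor>real N * s\<rfloor>) + 1"
    if "s \<in> {0..1}" for s
    using that by (auto simp: of_nat_nat)
  have "real N * t \<le> real N" using assms by (intro mult_left_le) auto
  then have "real (nat \<lfloor>real N * t\<rfloor>) \<le> real N" using bnd(1)[OF assms] by linarith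
  then show "nat \<lfloor>real N * t\<rfloor> \<le> N" by simp
  {
    assume "N > 0"
    then have "real (nat \<lfloor>real N * t\<rfloor>) / real N - t = (real (nat \<lfloor>real N * t\<rfloor>) - real N * t) / real N"
      by (simp add: field_simps)
    moreover have "\<bar>real (nat \<lfloor>real N * t\<rfloor>) - real N * t\<bar> \<le> 1"
      using bnd[OF assms] by linarith
    ultimately show "\<bar>real (nat \<lfloor>real N * t\<rfloor>) / real N - t\<bar> \<le> 1 / real N"
      by (simp only: abs_divide abs_of_nat) (intro divide_right_mono, auto)
  }
  {
    assume u: "u \<in> {0..1}" and N: "N > 0" and "\<bar>u - t\<bar> < 1 / real N"
    then have "u < t + 1 / real N" by linarith
    then have "real N * u < real N * (t + 1 / real N)"
      using N by (intro mult_strict_left_mono) auto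
    also have "\<dots> = real N * t + 1" using N by (simp add: field_simps)
    finally have "real (nat \<lfloor>real N * u\<rfloor>) < real (nat \<lfloor>real N * t\<rfloor>) + 2"
      using bnd[OF u] bnd[OF assms] by linarith
    then show "nat \<lfloor>real N * u\<rfloor> \<le> Suc (nat \<lfloor>real N * t\<rfloor>)" by linarith
  }
qed

text \<open>Induction on the number of steps: each new composition is continuous and maps
  \<open>w0\<close> into the open set \<open>U\<close>, so a smaller disc is still mapped into
  \<open>U\<close>. There are \<open>N\<close> transition maps but \<open>N + 1\<close> values,
  hence the bounds \<open>k < N\<close> and \<open>k \<le> N\<close>.\<close>

lemma holomorphic_iterates_on_ball:
  fixes H :: "nat \<Rightarrow> complex \<Rightarrow> complex" and v :: "nat \<Rightarrow> complex \<Rightarrow> complex"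
  assumes v0: "v 0 = (\<lambda>w. w)" and vS: "\<And>k. v (Suc k) = (\<lambda>w. H k (v k w))"
    and H: "\<And>k. k < N \<Longrightarrow> H k holomorphic_on U" and U: "open U"
    and base: "\<And>k. k \<le> N \<Longrightarrow> v k w0 \<in> U"
  shows "\<exists>\<rho>>0. \<forall>k\<le>N. v k holomorphic_on ball w0 \<rho> \<and> v k ` ball w0 \<rho> \<subseteq> U"
proof -
  have "n \<le> N \<Longrightarrow> \<exists>\<rho>>0. \<forall>k\<le>n. v k holomorphic_on ball w0 \<rho> \<and> v k ` ball w0 \<rho> \<subseteq> U" for n
  proof (induction n)
    case 0
    obtain \<rho> where "\<rho> > 0" "ball w0 \<rho> \<subseteq> U"
      using U base[of 0] v0 unfolding open_contains_ball by auto
    then show ?case by (intro exI[of _ \<rho>]) (simp add: v0)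
  next
    case (Suc n)
    then obtain \<rho> where \<rho>: "\<rho> > 0"
      "\<And>k. k \<le> n \<Longrightarrow> v k holomorphic_on ball w0 \<rho> \<and> v k ` ball w0 \<rho> \<subseteq> U"
      by auto
    have hol: "v (Suc n) holomorphic_on ball w0 \<rho>"
      unfolding vS
      using holomorphic_on_compose_gen[of "v n" "ball w0 \<rho>" "H n" U] \<rho>(2)[of n] H[of n] Suc.prems
      by (simp add: o_def)
    have "open (ball w0 \<rho> \<inter> v (Suc n) -` U)"
      using holomorphic_on_imp_continuous_on[OF hol] U continuous_on_open_vimage[OF open_ball]
      by (metis inf_commute)
    moreover have "w0 \<in> ball w0 \<rho> \<inter> v (Suc n) -` U"
      using \<rho>(1) base[OF Suc.prems] by simp
    ultimately obtain \<rho>' where \<rho>': "\<rho>' > 0" "ball w0 \<rho>' \<subseteq> ball w0 \<rho> \<inter> v (Suc n) -` U"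
      unfolding open_contains_ball by blast
    have "v k holomorphic_on ball w0 \<rho>' \<and> v k ` ball w0 \<rho>' \<subseteq> U" if "k \<le> Suc n" for k
    proof (cases "k = Suc n")
      case True
      then show ?thesis using hol \<rho>'(2) by (auto intro: holomorphic_on_subset)
    next
      case False
      then have "k \<le> n" using that by simp
      then show ?thesis using \<rho>(2)[of k] \<rho>'(2) by (fast intro: holomorphic_on_subset)
    qed
    then show ?case using \<rho>'(1) by blast
  qed
  then show ?thesis by blast
qed

text \<open>The map \<open>\<phi>\<close> is chosen before \<open>\<eta>\<close>, so one holomorphic
  function gives the end value for all nearby paths at once. It is the composition of the transition
  maps between local flows centred at successive nodes of \<open>\<gamma>\<close>.\<close>

lemma abel_flow_along_path:
  assumes \<gamma>: "continuous_on {0..1} \<gamma>" and Y: "abel_continuation p q \<gamma> w0 Y"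
  shows "\<exists>\<epsilon>>0. \<exists>\<rho>>0. \<exists>\<phi>. \<phi> holomorphic_on ball w0 \<rho> \<and>
    (\<forall>\<eta> w. (\<forall>u\<in>{0..1}. dist (\<eta> u) (\<gamma> u) < \<epsilon>) \<longrightarrow> \<eta> 0 = \<gamma> 0 \<longrightarrow> \<eta> 1 = \<gamma> 1 \<longrightarrow>
      w \<in> ball w0 \<rho> \<longrightarrow> (\<exists>Z. abel_continuation p q \<eta> w Z \<and> \<phi> w = Z 1 (\<eta> 1)))"
proof -
  have contY: "continuation_on {0..1} \<gamma> Y" and near: "abel_solution_near p q (\<gamma> 0) w0 (Y 0)"
    using Y by (auto simp: abel_continuation_def analytic_continuation_along_iff pathstart_def)
  have Y0: "Y 0 (\<gamma> 0) = w0" using near by (simp add: abel_solution_near_def)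
  have "compact (\<gamma> ` {0..1})" "compact ((\<lambda>t. Y t (\<gamma> t)) ` {0..1})"
    using \<gamma> continuous_on_continuation_values[OF contY \<gamma>] by (auto intro: compact_continuous_image)
  then have "bounded (\<gamma> ` {0..1})" "bounded ((\<lambda>t. Y t (\<gamma> t)) ` {0..1})"
    by (auto intro: compact_imp_bounded)
  then obtain R M where R: "\<And>t. t \<in> {0..1} \<Longrightarrow> norm (\<gamma> t) \<le> R"
    and M: "\<And>t. t \<in> {0..1} \<Longrightarrow> norm (Y t (\<gamma> t)) < M" and M0: "M > 0"
    unfolding bounded_pos_less by (meson imageI less_imp_le)
  obtain r sol where r: "r > 0"
    and init: "\<And>c v. norm c \<le> R \<Longrightarrow> norm v < M \<Longrightarrow> sol c v c = v"
    and sol: "\<And>c v x. norm c \<le> R \<Longrightarrow> norm v < M \<Longrightarrow> x \<in> ball c r \<Longrightarrow>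
      (sol c v has_field_derivative abel_rhs p q x (sol c v x)) (at x)"
    and hol: "\<And>c x. norm c \<le> R \<Longrightarrow> x \<in> ball c r \<Longrightarrow> (\<lambda>v. sol c v x) holomorphic_on ball 0 M"
    using abel_local_flow[of M R p q] M0 by (metis less_imp_le)
  have "uniformly_continuous_on {0..1} \<gamma>"
    using \<gamma> by (simp add: compact_uniformly_continuous)
  \<comment> \<open>The budget \<open>r / 4\<close>: a parameter and its node differ by less than
    \<open>r / 4\<close> on \<open>\<gamma>\<close>, the path \<open>\<eta>\<close> deviates by
    another \<open>r / 4\<close>, and passing to an adjacent centre costs a third, still within
    radius \<open>r\<close>.\<close>
  then obtain \<delta> where \<delta>: "\<delta> > 0"
    "\<And>t u. t \<in> {0..1} \<Longrightarrow> u \<in> {0..1} \<Longrightarrow> dist u t < \<delta> \<Longrightarrow> dist (\<gamma> u) (\<gamma> t) < r / 4"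
    unfolding uniformly_continuous_on_def using r by (metis zero_less_divide_iff zero_less_numeral)
  obtain N :: nat where N: "N > 0" "1 / real N < \<delta>"
    using nat_approx_posE[OF \<delta>(1)] by (metis of_nat_Suc zero_less_Suc)
  define c where "c k = \<gamma> (real k / real N)" for k
  \<comment> \<open>The values \<open>v k w\<close> refer to the centres \<open>c k\<close> on \<open>\<gamma>\<close> only, so the same chain serves all
    nearby paths \<open>\<eta>\<close>.\<close>
  define v where "v = rec_nat (\<lambda>w. w) (\<lambda>k f w. sol (c k) (f w) (c (Suc k)))"
  have v0: "v 0 = (\<lambda>w. w)" and vS: "\<And>k. v (Suc k) = (\<lambda>w. sol (c k) (v k w) (c (Suc k)))"
    by (simp_all add: v_def)
  have unit: "real k / real N \<in> {0..1}" if "k \<le> N" for k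
    using that N by (auto simp: field_simps)
  have cR: "norm (c k) \<le> R" if "k \<le> N" for k
    unfolding c_def using unit[OF that] by (rule R)
  have c_step: "dist (c (Suc k)) (c k) < r / 4" if "k < N" for k
    unfolding c_def
    by (rule \<delta>(2)) (use that N unit[of k] unit[of "Suc k"] in \<open>auto simp: dist_real_def field_simps\<close>)
  have c0: "c 0 = \<gamma> 0" and cN: "c N = \<gamma> 1" using N by (auto simp: c_def)
  \<comment> \<open>For \<open>w0\<close> itself the chain reproduces \<open>Y\<close> at the nodes.
    Between two nodes \<open>\<gamma>\<close> stays in one disc, so the local flow is a constant
    continuation there with the same initial germ as \<open>Y\<close>.\<close>
  have base: "v k w0 = Y (real k / real N) (c k)" if "k \<le> N" for k
    using that
  proof (induction k)
    case 0
    then show ?case by (simp add: v0 c0 Y0)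
  next
    case (Suc k)
    define I where "I = {real k / real N .. real (Suc k) / real N}"
    let ?f = "sol (c k) (v k w0)"
    have k: "k \<le> N" "k < N" using Suc.prems by auto
    have I: "I \<subseteq> {0..1}" using unit[OF k(1)] unit[OF Suc.prems] by (auto simp: I_def)
    have IH: "v k w0 = Y (real k / real N) (c k)" by (rule Suc.IH[OF k(1)])
    have vM: "norm (v k w0) < M" unfolding IH c_def using unit[OF k(1)] by (rule M)
    have ends: "real k / real N \<in> I" "real (Suc k) / real N \<in> I"
      by (auto simp: I_def divide_right_mono)
    have "\<gamma> ` I \<subseteq> ball (c k) r"
    proof
      fix x assume "x \<in> \<gamma> ` I"
      then obtain t where t: "t \<in> I" "x = \<gamma> t" by blast
      have "\<bar>t - real k / real N\<bar> \<le> 1 / real N"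
        using t N by (auto simp: I_def add_divide_distrib)
      then have "dist (\<gamma> t) (c k) < r / 4"
        unfolding c_def using t I N unit[OF k(1)] by (intro \<delta>(2)) (auto simp: dist_real_def)
      then show "x \<in> ball (c k) r" using t r by (simp add: dist_commute)
    qed
    moreover have "?f holomorphic_on ball (c k) r"
      using sol[OF cR[OF k(1)] vM] unfolding holomorphic_on_open[OF open_ball] by blast
    ultimately have const: "continuation_on I \<gamma> (\<lambda>_. ?f)"
      by (intro continuation_on_const) auto
    have "abel_solution_near p q (c k) (v k w0) ?f"
      unfolding abel_solution_near_def
      using init[OF cR[OF k(1)] vM] sol[OF cR[OF k(1)] vM] r
      by (auto intro!: eventually_nhds_in_open[of "ball (c k) r", THEN eventually_mono])
    then have "\<forall>\<^sub>F z in nhds (c k). Y (real k / real N) z = ?f z"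
      using abel_continuation_solves[OF Y \<gamma> unit[OF k(1)]] unfolding IH c_def
      by (intro abel_solution_near_unique) auto
    then have start: "\<forall>\<^sub>F z in nhds (\<gamma> (real k / real N)). Y (real k / real N) z = ?f z"
      by (simp only: c_def)
    have "\<forall>\<^sub>F z in nhds (\<gamma> (real (Suc k) / real N)). Y (real (Suc k) / real N) z = ?f z"
      by (rule continuation_unique[OF continuation_on_subset[OF contY I] const _
            continuous_on_subset[OF \<gamma> I] ends start]) (simp add: I_def)
    then have "Y (real (Suc k) / real N) (c (Suc k)) = ?f (c (Suc k))"
      unfolding c_def by (rule eventually_nhds_x_imp_x)
    then show ?case by (simp add: vS)
  qed
  \<comment> \<open>The values of \<open>Y\<close> have norm below \<open>M\<close>, so the chain
    from \<open>w0\<close> stays in the domain of the flows; by openness so do the chains from all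
    nearby \<open>w\<close>.\<close>
  have "\<exists>\<rho>>0. \<forall>k\<le>N. v k holomorphic_on ball w0 \<rho> \<and> v k ` ball w0 \<rho> \<subseteq> ball 0 M"
  proof (rule holomorphic_iterates_on_ball[OF v0 vS _ open_ball])
    show "(\<lambda>w. sol (c k) w (c (Suc k))) holomorphic_on ball 0 M" if "k < N" for k
      using that c_step[OF that] r by (intro hol cR) (auto simp: dist_commute)
    show "v k w0 \<in> ball 0 M" if "k \<le> N" for k
      using M[OF unit[OF that]] base[OF that] by (simp add: c_def)
  qed
  then obtain \<rho> where \<rho>: "\<rho> > 0" "\<And>k. k \<le> N \<Longrightarrow> v k holomorphic_on ball w0 \<rho>"
    "\<And>k w. k \<le> N \<Longrightarrow> w \<in> ball w0 \<rho> \<Longrightarrow> norm (v k w) < M"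
    by (auto simp: image_subset_iff)
  have "\<exists>Z. abel_continuation p q \<eta> w Z \<and> v N w = Z 1 (\<eta> 1)"
    if close: "\<forall>u\<in>{0..1}. dist (\<eta> u) (\<gamma> u) < r / 4"
      and \<eta>: "\<eta> 0 = \<gamma> 0" "\<eta> 1 = \<gamma> 1" and w: "w \<in> ball w0 \<rho>"
    for \<eta> w
  proof -
    define y where "y k = sol (c k) (v k w)" for k
    have yinit: "y k (c k) = v k w" if "k \<le> N" for k
      unfolding y_def by (rule init[OF cR[OF that] \<rho>(3)[OF that w]])
    have ysol: "(y k has_field_derivative abel_rhs p q x (y k x)) (at x)"
      if "k \<le> N" "x \<in> ball (c k) r" for k x
      unfolding y_def by (rule sol[OF cR[OF that(1)] \<rho>(3)[OF that(1) w] that(2)])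
    \<comment> \<open>The recursion for \<open>v\<close> makes the two flows agree at
      \<open>c (Suc k)\<close>; the intersection of two discs is convex, so uniqueness applies on
      all of it.\<close>
    have y_step: "y (Suc k) x = y k x"
      if k: "Suc k \<le> N" and x: "x \<in> ball (c k) r \<inter> ball (c (Suc k)) r" for k x
    proof (rule abel_unique[where U = "ball (c k) r \<inter> ball (c (Suc k)) r" and c = "c (Suc k)"
          and y = "y (Suc k)" and z = "y k" and p = p and q = q])
      show "c (Suc k) \<in> ball (c k) r \<inter> ball (c (Suc k)) r"
        using c_step[of k] k r by (auto simp: dist_commute)
      show "y (Suc k) (c (Suc k)) = y k (c (Suc k))"
        using yinit[OF k] by (simp add: y_def vS)
      show "(y (Suc k) has_field_derivative abel_rhs p q z (y (Suc k) z)) (at z)"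
        "(y k has_field_derivative abel_rhs p q z (y k z)) (at z)"
        if "z \<in> ball (c k) r \<inter> ball (c (Suc k)) r" for z
        using ysol[of "Suc k" z] ysol[of k z] k that by simp_all
    qed (use x in \<open>auto intro: convex_Int\<close>)
    define i where "i t = nat \<lfloor>real N * t\<rfloor>" for t
    define Z where "Z t = y (i t)" for t
    have iN: "i t \<le> N" if "t \<in> {0..1}" for t
      unfolding i_def by (rule floor_index(1)[OF that])
    have \<eta>_near: "dist (\<eta> t) (c (i t)) < r / 2" if t: "t \<in> {0..1}" for t
    proof -
      have "dist (\<gamma> t) (c (i t)) < r / 4"
        unfolding c_def
        using floor_index(2)[OF t N(1)] N(2) unit[OF iN[OF t]] t
        by (intro \<delta>(2)) (auto simp: dist_real_def i_def abs_minus_commute)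
      then show ?thesis using close t dist_triangle[of "\<eta> t" "c (i t)" "\<gamma> t"] by fastforce
    qed
    have "continuation_on {0..1} \<eta> Z"
      unfolding continuation_on_def
    proof (intro conjI ballI)
      fix t :: real assume t: "t \<in> {0..1}"
      have "y (i t) holomorphic_on ball (c (i t)) r"
        using ysol[OF iN[OF t]] unfolding holomorphic_on_open[OF open_ball] by blast
      moreover have "\<eta> t \<in> ball (c (i t)) r"
        using \<eta>_near[OF t] r by (simp add: dist_commute)
      ultimately show "Z t analytic_on {\<eta> t}"
        unfolding Z_def analytic_at using open_ball by blast
      have "\<forall>\<^sub>F z in nhds (\<eta> u). Z u z = Z t z" if u: "u \<in> {0..1}" and ut: "\<bar>u - t\<bar> < 1 / real N" for u
      proof -
        \<comment> \<open>\<open>\<eta> u\<close> is within \<open>r / 2\<close> of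
          \<open>c (i u)\<close>, hence within \<open>3 r / 4\<close> of \<open>c (i t)\<close>; it
          lies in the overlap, where the two flows coincide.\<close>
        let ?W = "ball (c (i t)) r \<inter> ball (c (i u)) r"
        have idx: "i u \<le> Suc (i t)" "i t \<le> Suc (i u)"
          using floor_index(3)[OF t u N(1) ut] floor_index(3)[OF u t N(1)] ut
          by (auto simp: i_def abs_minus_commute)
        then consider "i u = i t" | "i u = Suc (i t)" | "i t = Suc (i u)" by linarith
        then have "dist (c (i u)) (c (i t)) < r / 4 \<and> (\<forall>x\<in>?W. Z u x = Z t x)"
        proof cases
          case 1
          then show ?thesis using r by (simp add: Z_def)
        next
          case 2
          then show ?thesis using c_step[of "i t"] iN[OF u] y_step[of "i t"] by (simp add: Z_def)
        next
          case 3
          then show ?thesis using c_step[of "i u"] iN[OF t] y_step[of "i u"] by (simp add: Z_def dist_commute)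
        qed
        moreover from this have "\<eta> u \<in> ?W"
          using \<eta>_near[OF u] r dist_triangle[of "\<eta> u" "c (i t)" "c (i u)"] by (auto simp: dist_commute)
        moreover have "open ?W" by (intro open_Int open_ball)
        ultimately show ?thesis unfolding eventually_nhds by blast
      qed
      then show "\<exists>d>0. \<forall>u\<in>{0..1}. \<bar>u - t\<bar> < d \<longrightarrow> (\<forall>\<^sub>F z in nhds (\<eta> u). Z u z = Z t z)"
        using N(1) by (intro exI[of _ "1 / real N"]) simp
    qed
    \<comment> \<open>The end parameters are nodes: index 0 at the start and \<open>N\<close> at the
      end. Since \<open>\<eta>\<close> shares its endpoints with \<open>\<gamma>\<close>, the first
      and last flows are centred exactly at the endpoints of \<open>\<eta>\<close>.\<close>
    moreover have Z0: "Z 0 = y 0" and Z1: "Z 1 = y N" by (auto simp: Z_def i_def)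
    have "abel_solution_near p q (\<eta> 0) w (Z 0)"
      unfolding abel_solution_near_def Z0 \<eta>(1) c0[symmetric]
      using yinit[of 0] ysol[of 0] r
      by (auto simp: v0 intro!: eventually_nhds_in_open[of "ball (c 0) r", THEN eventually_mono])
    ultimately have "abel_continuation p q \<eta> w Z"
      by (simp add: abel_continuation_def analytic_continuation_along_iff pathstart_def)
    moreover have "v N w = Z 1 (\<eta> 1)"
      using yinit[of N] by (simp add: Z1 \<eta>(2) cN)
    ultimately show ?thesis by blast
  qed
  then show ?thesis
    using r \<rho>(1) \<rho>(2)[of N] by (intro exI[of _ "r / 4"] conjI exI[of _ \<rho>] exI[of _ "v N"]) auto
qed

section \<open>Gluing the local Poincare mappings along \<open>\<sigma>\<close>\<close>

theorem theorem3p1: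
  fixes p q :: "complex poly" and a b w\<^sub>0 w\<^sub>1 :: complex
    and s \<sigma> :: "real \<Rightarrow> complex" and S :: "real \<Rightarrow> real \<Rightarrow> complex"
  assumes "poly q b \<noteq> 0"
    and "path s" and "pathstart s = a" and "pathfinish s = b"
    and "path \<sigma>" and "pathstart \<sigma> = w\<^sub>0" and "pathfinish \<sigma> = w\<^sub>1"
    and "continuous_on ({0..1} \<times> {0..1}) (\<lambda>(t, u). S t u)"
    and "\<And>t. t \<in> {0..1} \<Longrightarrow> pathstart (S t) = a"
    and "\<And>t. t \<in> {0..1} \<Longrightarrow> pathfinish (S t) = b"
    and "\<And>u. u \<in> {0..1} \<Longrightarrow> S 0 u = s u"
    and "\<And>t. t \<in> {0..1} \<Longrightarrow> \<exists>Y. abel_continuation p q (S t) (\<sigma> t) Y"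
  shows "(\<exists>\<Phi>. analytic_continuation_along \<sigma> \<Phi> \<and> poincare_germ p q s w\<^sub>0 (\<Phi> 0)) \<and>
    (\<forall>\<Phi>. analytic_continuation_along \<sigma> \<Phi> \<and> poincare_germ p q s w\<^sub>0 (\<Phi> 0)
           \<longrightarrow> poincare_germ p q (S 1) w\<^sub>1 (\<Phi> 1))"
proof -
  have S_cont: "continuous_on {0..1} (S t)" if "t \<in> {0..1}" for t
  proof -
    have "continuous_on {0..1} (Pair t)"
      using continuous_on_Pair[OF continuous_on_const continuous_on_id] by simp
    then show ?thesis
      using continuous_on_compose2[OF assms(8), of "{0..1}" "Pair t"] that by (auto simp: image_subset_iff)
  qed
  have S_ends: "S t 0 = a" "S t 1 = b" if "t \<in> {0..1}" for t
    using assms(9,10)[OF that] by (auto simp: pathstart_def pathfinish_def)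
  have \<sigma>: "continuous_on {0..1} \<sigma>" "\<sigma> 0 = w\<^sub>0" "\<sigma> 1 = w\<^sub>1"
    using assms(5-7) by (auto simp: path_def pathstart_def pathfinish_def)
  have s_cont: "continuous_on {0..1} s" and s_ends: "s 0 = a" "s 1 = b"
    using assms(2-4) by (auto simp: path_def pathstart_def pathfinish_def)
  \<comment> \<open>One function covers all paths \<open>\<eta>\<close> near \<open>S t\<close>:
    this allows \<open>\<Psi> t\<close> to be compared with \<open>\<Psi> u\<close> along the common
    path \<open>S u\<close>.\<close>
  define good where "good t \<epsilon> \<rho> \<phi> \<longleftrightarrow> 0 < \<epsilon> \<and> 0 < \<rho> \<and> \<phi> holomorphic_on ball (\<sigma> t) \<rho> \<and>
      (\<forall>\<eta> w. (\<forall>u\<in>{0..1}. dist (\<eta> u) (S t u) < \<epsilon>) \<longrightarrow> \<eta> 0 = a \<longrightarrow> \<eta> 1 = b \<longrightarrow>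
        w \<in> ball (\<sigma> t) \<rho> \<longrightarrow> (\<exists>Z. abel_continuation p q \<eta> w Z \<and> \<phi> w = Z 1 b))"
    for t \<epsilon> \<rho> and \<phi> :: "complex \<Rightarrow> complex"
  have "\<exists>\<epsilon> \<rho> \<phi>. good t \<epsilon> \<rho> \<phi>" if t: "t \<in> {0..1}" for t
  proof -
    obtain Y where "abel_continuation p q (S t) (\<sigma> t) Y" using assms(12)[OF t] by blast
    from abel_flow_along_path[OF S_cont[OF t] this] obtain \<epsilon> \<rho> \<phi> where
      "\<epsilon> > 0" "\<rho> > 0" "\<phi> holomorphic_on ball (\<sigma> t) \<rho>"
      and *: "\<And>\<eta> w. (\<forall>u\<in>{0..1}. dist (\<eta> u) (S t u) < \<epsilon>) \<Longrightarrow> \<eta> 0 = S t 0 \<Longrightarrow> \<eta> 1 = S t 1 \<Longrightarrow>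
        w \<in> ball (\<sigma> t) \<rho> \<Longrightarrow> \<exists>Z. abel_continuation p q \<eta> w Z \<and> \<phi> w = Z 1 (\<eta> 1)"
      by blast
    moreover have "\<exists>Z. abel_continuation p q \<eta> w Z \<and> \<phi> w = Z 1 b"
      if "\<forall>u\<in>{0..1}. dist (\<eta> u) (S t u) < \<epsilon>" "\<eta> 0 = a" "\<eta> 1 = b" "w \<in> ball (\<sigma> t) \<rho>" for \<eta> w
      using *[OF that(1) _ _ that(4)] that(2,3) S_ends[OF t] by simp
    ultimately show ?thesis unfolding good_def by blast
  qed
  then obtain \<epsilon> \<rho> \<Psi> where "\<And>t. t \<in> {0..1} \<Longrightarrow> good t (\<epsilon> t) (\<rho> t) (\<Psi> t)"
    by metis
  then have \<epsilon>: "\<epsilon> t > 0" and \<rho>: "\<rho> t > 0" and hol: "\<Psi> t holomorphic_on ball (\<sigma> t) (\<rho> t)"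
    and cont: "\<lbrakk>\<forall>u\<in>{0..1}. dist (\<eta> u) (S t u) < \<epsilon> t; \<eta> 0 = a; \<eta> 1 = b; w \<in> ball (\<sigma> t) (\<rho> t)\<rbrakk>
      \<Longrightarrow> \<exists>Z. abel_continuation p q \<eta> w Z \<and> \<Psi> t w = Z 1 b"
    if "t \<in> {0..1}" for t \<eta> w
    using that unfolding good_def by blast+
  have near: "\<forall>\<^sub>F w in nhds (\<sigma> t). w \<in> ball (\<sigma> t) (\<rho> t)" if "t \<in> {0..1}" for t
    using \<rho>[OF that] by (intro eventually_nhds_in_open) auto
  \<comment> \<open>Compactness of the square makes \<open>S u\<close> close to \<open>S t\<close>
    uniformly in the path parameter.\<close>
  have S_unif: "uniformly_continuous_on ({0..1} \<times> {0..1}) (\<lambda>(t, u). S t u)"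
    using assms(8) by (intro compact_uniformly_continuous compact_Times) auto
  have \<Psi>: "analytic_continuation_along \<sigma> \<Psi>"
    unfolding analytic_continuation_along_def
  proof (intro conjI ballI)
    fix t :: real assume t: "t \<in> {0..1}"
    show "\<Psi> t analytic_on {\<sigma> t}"
      using hol[OF t] \<rho>[OF t] unfolding analytic_at_ball by blast
    obtain d where d: "d > 0" "\<And>x y. x \<in> {0..1} \<times> {0..1} \<Longrightarrow> y \<in> {0..1} \<times> {0..1} \<Longrightarrow>
        dist y x < d \<Longrightarrow> dist (case_prod S y) (case_prod S x) < \<epsilon> t"
      using S_unif \<epsilon>[OF t] unfolding uniformly_continuous_on_def by blast
    obtain e where e: "e > 0" "\<And>u. u \<in> {0..1} \<Longrightarrow> dist u t < e \<Longrightarrow> dist (\<sigma> u) (\<sigma> t) < \<rho> t"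
      using \<sigma>(1) t \<rho>[OF t] unfolding continuous_on_iff by blast
    \<comment> \<open>\<open>d\<close> puts \<open>S u\<close> within reach of
      \<open>\<Psi> t\<close>, and \<open>e\<close> puts \<open>\<sigma> u\<close> into its disc.
      Then \<open>\<Psi> t z\<close> and \<open>\<Psi> u z\<close> are both end values of the
      solution from \<open>z\<close> continued along \<open>S u\<close>, hence equal.\<close>
    have "\<forall>\<^sub>F z in nhds (\<sigma> u). \<Psi> u z = \<Psi> t z" if u: "u \<in> {0..1}" and ut: "\<bar>u - t\<bar> < min d e" for u
    proof -
      have close: "\<forall>x\<in>{0..1}. dist (S u x) (S t x) < \<epsilon> t"
        using d(2)[of "(t, x)" "(u, x)" for x] t u ut by (auto simp: dist_Pair_Pair dist_real_def)
      have self: "\<forall>x\<in>{0..1}. dist (S u x) (S u x) < \<epsilon> u"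
        using \<epsilon>[OF u] by simp
      have "\<forall>\<^sub>F z in nhds (\<sigma> u). z \<in> ball (\<sigma> t) (\<rho> t)"
        using e(2)[OF u] ut by (intro eventually_nhds_in_open) (auto simp: dist_real_def dist_commute)
      with near[OF u] show ?thesis
      proof eventually_elim
        case (elim z)
        obtain Z where Z: "abel_continuation p q (S u) z Z" "\<Psi> t z = Z 1 b"
          using cont[OF t close S_ends[OF u] elim(2)] by blast
        obtain Z' where Z': "abel_continuation p q (S u) z Z'" "\<Psi> u z = Z' 1 b"
          using cont[OF u self S_ends[OF u] elim(1)] by blast
        have "\<forall>\<^sub>F x in nhds (S u 1). Z' 1 x = Z 1 x"
          by (rule abel_continuation_unique[OF Z'(1) Z(1) S_cont[OF u]]) simp
        from eventually_nhds_x_imp_x[OF this] show ?case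
          using Z(2) Z'(2) S_ends[OF u] by simp
      qed
    qed
    then show "\<exists>\<delta>>0. \<forall>u\<in>{0..1}. \<bar>u - t\<bar> < \<delta> \<longrightarrow> (\<forall>\<^sub>F z in nhds (\<sigma> u). \<Psi> u z = \<Psi> t z)"
      using d(1) e(1) by (intro exI[of _ "min d e"]) simp
  qed
  \<comment> \<open>A general \<open>\<eta>\<close> agreeing with \<open>S t\<close> on the unit
    interval is needed because \<open>s\<close> and \<open>S 0\<close> are known to coincide only
    there.\<close>
  have germ: "poincare_germ p q \<eta> (\<sigma> t) (\<Psi> t)"
    if t: "t \<in> {0..1}" and \<eta>: "\<And>u. u \<in> {0..1} \<Longrightarrow> \<eta> u = S t u" for t \<eta>
    unfolding poincare_germ_def
    using near[OF t]
  proof eventually_elim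
    case (elim w)
    have "\<eta> 0 = a" "\<eta> 1 = b" using \<eta> S_ends[OF t] by auto
    then show ?case
      using cont[OF t, of \<eta> w] \<eta> \<epsilon>[OF t] elim by (auto simp: pathfinish_def)
  qed
  have germ0: "poincare_germ p q s w\<^sub>0 (\<Psi> 0)"
    using germ[of 0 s] assms(11) \<sigma>(2) by auto
  show ?thesis
  proof (intro conjI exI[of _ \<Psi>] allI impI \<Psi> germ0)
    fix \<Phi> assume \<Phi>: "analytic_continuation_along \<sigma> \<Phi> \<and> poincare_germ p q s w\<^sub>0 (\<Phi> 0)"
    have "\<forall>\<^sub>F w in nhds w\<^sub>0. \<exists>Y. abel_continuation p q s w Y \<and> \<Phi> 0 w = Y 1 (pathfinish s)"
      using \<Phi> by (simp add: poincare_germ_def)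
    moreover have "\<forall>\<^sub>F w in nhds w\<^sub>0. \<exists>Y. abel_continuation p q s w Y \<and> \<Psi> 0 w = Y 1 (pathfinish s)"
      using germ0 by (simp add: poincare_germ_def)
    \<comment> \<open>The relation \<open>poincare_germ\<close> determines the germ, since continued
      solutions along \<open>s\<close> are unique. Any continuation \<open>\<Phi>\<close> thus
      starts with the germ of \<open>\<Psi> 0\<close>, agrees with \<open>\<Psi>\<close> along
      \<open>\<sigma>\<close>, and inherits the final germ of \<open>\<Psi> 1\<close>.\<close>
    ultimately have "\<forall>\<^sub>F w in nhds w\<^sub>0. \<Phi> 0 w = \<Psi> 0 w"
    proof eventually_elim
      case (elim w)
      then obtain Y Z where YZ: "abel_continuation p q s w Y" "abel_continuation p q s w Z"
        "\<Phi> 0 w = Y 1 (s 1)" "\<Psi> 0 w = Z 1 (s 1)"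
        by (auto simp: pathfinish_def)
      have "\<forall>\<^sub>F x in nhds (s 1). Y 1 x = Z 1 x"
        by (rule abel_continuation_unique[OF YZ(1,2) s_cont]) simp
      from eventually_nhds_x_imp_x[OF this] show ?case
        using YZ(3,4) by simp
    qed
    then have "\<forall>\<^sub>F w in nhds (\<sigma> 0). \<Phi> 0 w = \<Psi> 0 w" by (simp add: \<sigma>)
    then have "\<forall>\<^sub>F w in nhds (\<sigma> 1). \<Phi> 1 w = \<Psi> 1 w"
      using \<Phi> \<Psi> \<sigma>(1) unfolding analytic_continuation_along_iff
      by (intro continuation_unique[of "{0..1}" \<sigma> \<Phi> \<Psi> 0 1]) auto
    moreover have "poincare_germ p q (S 1) w\<^sub>1 (\<Psi> 1)"
      using germ[of 1 "S 1"] \<sigma>(3) by simp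
    ultimately show "poincare_germ p q (S 1) w\<^sub>1 (\<Phi> 1)"
      unfolding poincare_germ_def \<sigma>(3) by eventually_elim simp
  qed
qed

end
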